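(* $\displaystyle\lim_{n\to\infty} \frac{p_{\mathbb P}(n)}{M_{\{1\}\cup\mathbb P}(n)} = 0$, and consequently $\displaystyle\lim_{n\to\infty}\frac{p_{\mathbb P}(n)}{M(n)} = 0$.
   Context: $\mathbb P$ is the set of primes. $p_{\mathbb P}(n)$ is the number of partitions of $n$ into prime parts. For a set $T$ of positive integers, $M_T(n)$ is the number of distinct values of the multinomial coefficients $n!/(\lambda_1!\cdots\lambda_r!)$ as $(\lambda_1,\dots,\lambda_r)$ ranges over the partitions of $n$ with all parts in $T$; $M(n)$ is $M_T(n)$ for $T$ the set of all positive integers. *)

theory Defs
  imports "HOL-Analysis.Analysis" "HOL-Library.Multiset" "HOL-Computational_Algebra.Primes"
begin

text \<open>A partition is represented by the multiset of its parts.\<close>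

definition partitions_into :: "nat set \<Rightarrow> nat \<Rightarrow> nat multiset set" where
  "partitions_into T n = {P. (\<forall>k \<in># P. 0 < k \<and> k \<in> T) \<and> \<Sum>\<^sub># P = n}"

definition num_prime_partitions :: "nat \<Rightarrow> nat" where
  "num_prime_partitions n = card (partitions_into {p. prime p} n)"

definition multinomial_of :: "nat multiset \<Rightarrow> real" where
  "multinomial_of P = fact (\<Sum>\<^sub># P) / (\<Prod>k \<in># P. fact k)"

definition num_multinomials :: "nat set \<Rightarrow> nat \<Rightarrow> nat" where
  "num_multinomials T n = card (multinomial_of ` partitions_into T n)"

text \<open>Finiteness ensures that the cardinalities above are genuine counts.\<close>

lemma finite_partitions_into: "finite (partitions_into T n)"
proof -
  have size_le: "size P \<le> \<Sum>\<^sub># P" if "\<forall>k \<in># P. 0 < k" for P :: "nat multiset"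
    using that by (induction P) auto
  have part_le: "k \<le> \<Sum>\<^sub># P" if "k \<in># P" for k :: nat and P
    using that by (metis le_add1 multi_member_split sum_mset.add_mset)
  have "partitions_into T n \<subseteq> mset ` {xs. set xs \<subseteq> {..n} \<and> length xs \<le> n}"
  proof
    fix P assume l: "P \<in> partitions_into T n"
    obtain xs where xs: "P = mset xs" by (metis ex_mset)
    have "set xs \<subseteq> {..n}" "length xs \<le> n"
      using l size_le[of P] part_le[of _ P] by (auto simp: partitions_into_def xs)
    then show "P \<in> mset ` {xs. set xs \<subseteq> {..n} \<and> length xs \<le> n}"
      using xs by blast
  qed
  then show ?thesis
    using finite_lists_length_le[of "{..n}" n] by (meson finite_atMost finite_imageI finite_subset)
qed

end

theory Submission
  imports Defs
begin

text \<open>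
  The largest prime in a partition can be read off from the product of the factorials of the
  parts. Hence these products determine a multiset of primes, and padding with ones shows that
  \<open>M\<^bsub>{1} \<union> \<P>\<^esub>(n)\<close> is at least the number \<open>S(n)\<close> of prime partitions of all integers \<open>m \<le> n\<close>.

  Deleting one part from a partition of \<open>n\<close> gives a partition of a smaller integer, and the deleted
  part is determined by the result. So the numbers of distinct parts, summed over all partitions
  of \<open>n\<close>, total at most \<open>S(n)\<close>. Partitions with at most \<open>K\<close> distinct parts number at most
  \<open>(n + 1)\<^bsup>2K\<^esup>\<close>, whereas \<open>S(n)\<close> grows faster than any polynomial because there are
  infinitely many primes. Therefore \<open>p(n) \<le> S(n) / K + o(S(n))\<close> for every \<open>K\<close>.
\<close>

text \<open>For \<open>T\<close> the set of primes, the cardinality is the \<open>S(n)\<close> of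
  the overview; the asymptotic comparison is made for any infinite \<open>T\<close>.\<close>

definition partitions_upto :: "nat set \<Rightarrow> nat \<Rightarrow> nat multiset set" where
  "partitions_upto T n = {P. (\<forall>k \<in># P. 0 < k \<and> k \<in> T) \<and> \<Sum>\<^sub># P \<le> n}"

lemma finite_partitions_upto: "finite (partitions_upto T n)"
proof -
  have "partitions_upto T n = (\<Union>m\<le>n. partitions_into T m)"
    by (auto simp: partitions_upto_def partitions_into_def)
  then show ?thesis
    by (simp add: finite_partitions_into)
qed

text \<open>Double counting: the left side counts pairs \<open>(P, q)\<close> with
  \<open>q \<in># P\<close>. Deleting one copy of \<open>q\<close> is injective on these pairs,
  since \<open>q\<close> is \<open>n\<close> minus the sum of the remaining parts.\<close>

lemma sum_card_distinct_parts_le: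
  "(\<Sum>P\<in>partitions_into T n. card (set_mset P)) \<le> card (partitions_upto T n)"
proof -
  let ?f = "\<lambda>(P, q). P - {#q::nat#}"
  let ?D = "SIGMA P:partitions_into T n. set_mset P"
  have split: "P = add_mset q (P - {#q#}) \<and> q = n - \<Sum>\<^sub># (P - {#q#}) \<and> \<Sum>\<^sub># (P - {#q#}) \<le> n"
    if "(P, q) \<in> ?D" for P q
  proof -
    have "q \<in># P" "\<Sum>\<^sub># P = n" using that by (auto simp: partitions_into_def)
    moreover from this obtain R where "P = add_mset q R" by (meson multi_member_split)
    ultimately show ?thesis by auto
  qed
  have "inj_on ?f ?D"
  proof (rule inj_onI, clarify)
    fix P q P' q'
    assume "P \<in> partitions_into T n" "q \<in># P" "P' \<in> partitions_into T n" "q' \<in># P'"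
      and "P - {#q#} = P' - {#q'#}"
    then show "P = P' \<and> q = q'" using split[of P q] split[of P' q'] by auto
  qed
  moreover have "?f ` ?D \<subseteq> partitions_upto T n"
  proof clarify
    fix P q assume *: "P \<in> partitions_into T n" "q \<in># P"
    then show "P - {#q#} \<in> partitions_upto T n"
      using split[of P q] by (auto simp: partitions_upto_def partitions_into_def dest: in_diffD)
  qed
  ultimately have "card ?D \<le> card (partitions_upto T n)"
    by (rule card_inj_on_le) (rule finite_partitions_upto)
  then show ?thesis by (simp add: finite_partitions_into)
qed

text \<open>Such a partition is encoded by \<open>K\<close> pairs (part, multiplicity) with entries
  in \<open>{..n}\<close>, which leaves \<open>(n + 1)^2\<close> choices per pair.\<close>

lemma card_few_distinct_parts_le:
  "card {P \<in> partitions_into T n. card (set_mset P) \<le> K} \<le> (n + 1) ^ (2 * K)"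
proof -
  let ?X = "{xs. set xs \<subseteq> {..n} \<times> {..n} \<and> length xs = K}"
  let ?f = "\<lambda>xs. \<Sum>(p, a)\<leftarrow>xs. replicate_mset a (p::nat)"
  have "{P \<in> partitions_into T n. card (set_mset P) \<le> K} \<subseteq> ?f ` ?X"
  proof clarify
    fix P assume P: "P \<in> partitions_into T n" "card (set_mset P) \<le> K"
    have le: "p \<le> n \<and> count P p \<le> n" if "p \<in># P" for p
    proof -
      \<comment> \<open>Both factors are at least 1, so each is at most the product and hence at
        most \<open>n\<close>.\<close>
      have "count P p * p \<le> \<Sum>\<^sub># P"
        by (induction P) auto
      moreover have "count P p > 0" "p > 0" "\<Sum>\<^sub># P = n"
        using that P by (auto simp: partitions_into_def)
      ultimately show ?thesis
        by (metis One_nat_def Suc_leI le_trans mult.commute mult.right_neutral mult_le_mono2)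
    qed
    obtain ys where ys: "set ys = set_mset P" "distinct ys"
      using finite_distinct_list[OF finite_set_mset[of P]] by blast
    \<comment> \<open>The pairs \<open>(0, 0)\<close> decode to the empty multiset; they bring the
      length to exactly \<open>K\<close> without changing the decoded partition.\<close>
    define xs where
      "xs = map (\<lambda>p. (p, count P p)) ys @ replicate (K - card (set_mset P)) (0, 0)"
    have "length xs = K"
      using P ys by (simp add: xs_def flip: distinct_card)
    moreover have "set xs \<subseteq> {..n} \<times> {..n}"
      using le ys by (auto simp: xs_def)
    moreover have "sum_list (replicate m {#}) = {#}" for m :: nat
      by (induction m) auto
    then have "?f xs = (\<Sum>p\<in>set ys. replicate_mset (count P p) p)"
      using ys(2) by (simp add: xs_def o_def sum_list_distinct_conv_sum_set)
    then have "?f xs = P"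
      by (simp add: ys multiset_eq_iff count_sum not_in_iff)
    ultimately show "P \<in> ?f ` ?X" by blast
  qed
  moreover have "finite ?X" by (rule finite_lists_length_eq) simp
  ultimately have "card {P \<in> partitions_into T n. card (set_mset P) \<le> K} \<le> card ?X"
    by (meson surj_card_le)
  also have "\<dots> = (n + 1) ^ (2 * K)"
    by (subst card_lists_length_eq)
       (simp_all add: card_cartesian_product power_mult power2_eq_square)
  finally show ?thesis .
qed

text \<open>The multiplicities of the elements of \<open>Q\<close> can be chosen independently in
  \<open>{..n div \<Sum>Q}\<close>: the total stays at most \<open>n\<close>, and the multiset
  determines the choice.\<close>

lemma card_partitions_upto_ge:
  assumes "finite Q" "Q \<subseteq> T" "0 \<notin> Q"
  shows "(n div \<Sum>Q + 1) ^ card Q \<le> card (partitions_upto T n)"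
proof -
  define t where "t = n div \<Sum>Q"
  let ?f = "\<lambda>g. \<Sum>p\<in>Q. replicate_mset (g p) (p::nat)"
  let ?X = "Q \<rightarrow>\<^sub>E {..t}"
  have count: "count (?f g) p = (if p \<in> Q then g p else 0)" for g p
    using assms(1) by (simp add: count_sum)
  have "inj_on ?f ?X"
  proof (rule inj_onI)
    fix g h assume "g \<in> ?X" "h \<in> ?X" and eq: "?f g = ?f h"
    then have "g i = h i" if "i \<in> Q" for i
      using count[of g i] count[of h i] that by simp
    with \<open>g \<in> ?X\<close> \<open>h \<in> ?X\<close> show "g = h"
      by (rule PiE_ext)
  qed
  moreover have "?f ` ?X \<subseteq> partitions_upto T n"
  proof clarify
    fix g assume g: "g \<in> ?X"
    have "\<Sum>\<^sub># (?f g) = (\<Sum>p\<in>Q. g p * p)"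
      using assms(1) by (induction Q) auto
    also have "\<dots> \<le> (\<Sum>p\<in>Q. t * p)"
      using g by (intro sum_mono mult_right_mono) auto
    also have "\<dots> = t * \<Sum>Q" by (simp add: sum_distrib_left)
    also have "\<dots> \<le> n" by (simp add: t_def)
    finally have "\<Sum>\<^sub># (?f g) \<le> n" .
    moreover have "0 < p \<and> p \<in> T" if "p \<in># ?f g" for p
    proof -
      have "p \<in> Q" using that count[of g p] by (metis not_in_iff)
      then show ?thesis using assms by (auto intro: gr0I)
    qed
    ultimately show "?f g \<in> partitions_upto T n"
      by (simp add: partitions_upto_def)
  qed
  ultimately have "card ?X \<le> card (partitions_upto T n)"
    by (rule card_inj_on_le) (rule finite_partitions_upto)
  then show ?thesis using assms(1) by (simp add: card_PiE t_def)
qed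

lemma card_partitions_upto_pos: "card (partitions_upto T n) > 0"
proof -
  have "{#} \<in> partitions_upto T n" by (simp add: partitions_upto_def)
  then show ?thesis using finite_partitions_upto card_gt_0_iff by blast
qed

text \<open>Each partition with more than \<open>K\<close> distinct parts contributes more than
  \<open>K\<close> to the sum of the numbers of distinct parts; the others are polynomially
  few.\<close>

lemma card_partitions_into_le:
  "K * card (partitions_into T n) \<le> card (partitions_upto T n) + K * (n + 1) ^ (2 * K)"
proof -
  let ?A = "partitions_into T n"
  let ?F = "{P \<in> ?A. card (set_mset P) \<le> K}"
  have fin: "finite ?A" by (rule finite_partitions_into)
  have "K * card (?A - ?F) = (\<Sum>P\<in>?A - ?F. K)" by simp
  also have "\<dots> \<le> (\<Sum>P\<in>?A - ?F. card (set_mset P))" by (intro sum_mono) auto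
  also have "\<dots> \<le> (\<Sum>P\<in>?A. card (set_mset P))" using fin by (intro sum_mono2) auto
  also have "\<dots> \<le> card (partitions_upto T n)" by (rule sum_card_distinct_parts_le)
  finally have "K * card (?A - ?F) \<le> card (partitions_upto T n)" .
  moreover have "card ?A = card (?A - ?F) + card ?F"
    using fin by (simp add: card_Diff_subset card_mono)
  moreover have "K * card ?F \<le> K * (n + 1) ^ (2 * K)"
    using card_few_distinct_parts_le by (rule mult_le_mono2)
  ultimately show ?thesis by (simp only: distrib_left)
qed

lemma polynomial_over_card_partitions_upto_tendsto_0:
  assumes "infinite T"
  shows "(\<lambda>n. real ((n + 1) ^ d) / real (card (partitions_upto T n))) \<longlonglongrightarrow> 0"
proof -
  have "infinite (T - {0})" using assms by simp
  \<comment> \<open>With \<open>d + 1\<close> available parts the denominator has growth of degree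
    at least \<open>d + 1\<close>, one more than the numerator.\<close>
  then obtain Q where Q: "finite Q" "card Q = Suc d" "Q \<subseteq> T - {0}"
    using infinite_arbitrarily_large by metis
  define c where "c = \<Sum>Q"
  have "Q \<noteq> {}" using Q by auto
  then have c: "c > 0" unfolding c_def using Q by (intro sum_pos) auto
  have bound: "real ((n + 1) ^ d) / real (card (partitions_upto T n)) \<le> real c ^ Suc d / real (n + 1)"
    for n
  proof -
    \<comment> \<open>This undoes the rounding in \<open>n div c\<close>, at the cost of the
      constant factor \<open>c\<close>.\<close>
    have "n + 1 \<le> c * (n div c + 1)"
      using c by (metis Suc_eq_plus1 Suc_leI dividend_less_times_div mult_Suc_right)
    then have "(n + 1) ^ Suc d \<le> (c * (n div c + 1)) ^ Suc d" by (rule power_mono) simp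
    also have "\<dots> \<le> c ^ Suc d * card (partitions_upto T n)"
      using card_partitions_upto_ge[of Q T n] Q
      unfolding power_mult_distrib c_def by (intro mult_left_mono) auto
    finally have "real ((n + 1) ^ Suc d) \<le> real (c ^ Suc d * card (partitions_upto T n))"
      by (rule of_nat_mono)
    then have "real ((n + 1) ^ d) * real (n + 1) \<le> real c ^ Suc d * real (card (partitions_upto T n))"
      by (simp only: power_Suc of_nat_mult of_nat_power mult_ac)
    moreover have "real (n + 1) > 0" "real (card (partitions_upto T n)) > 0"
      using card_partitions_upto_pos by auto
    ultimately show ?thesis
      by (simp only: pos_divide_le_eq times_divide_eq_left pos_le_divide_eq)
  qed
  have lim: "(\<lambda>n. real c ^ Suc d / real (n + 1)) \<longlonglongrightarrow> 0"
    using LIMSEQ_Suc[OF lim_const_over_n[of "real c ^ Suc d"]] by simp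
  show ?thesis
    by (rule tendsto_sandwich[OF _ _ tendsto_const lim]) (use bound in auto)
qed

text \<open>The error is split in two: \<open>K\<close> is fixed first to make \<open>1 / K\<close>
  small, so the exponent \<open>2 * K\<close> is constant when \<open>n\<close> grows and the
  polynomial term vanishes.\<close>

lemma partitions_into_over_upto_tendsto_0:
  assumes "infinite T"
  shows "(\<lambda>n. real (card (partitions_into T n)) / real (card (partitions_upto T n))) \<longlonglongrightarrow> 0"
proof (rule LIMSEQ_I)
  fix e :: real assume "e > 0"
  then obtain K where K: "K > 0" "1 / real K < e / 2"
    by (metis half_gt_zero inverse_eq_divide reals_Archimedean zero_less_Suc)
  have "eventually (\<lambda>n. real ((n + 1) ^ (2 * K)) / real (card (partitions_upto T n)) < e / 2) sequentially"
    using \<open>e > 0\<close> by (intro order_tendstoD(2)[OF polynomial_over_card_partitions_upto_tendsto_0[OF assms]]) simp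
  then obtain N where N:
    "\<And>n. n \<ge> N \<Longrightarrow> real ((n + 1) ^ (2 * K)) / real (card (partitions_upto T n)) < e / 2"
    by (auto simp: eventually_sequentially)
  show "\<exists>N. \<forall>n\<ge>N. norm (real (card (partitions_into T n)) / real (card (partitions_upto T n)) - 0) < e"
  proof (intro exI allI impI)
    fix n assume "n \<ge> N"
    define a where "a = real (card (partitions_into T n))"
    define s where "s = real (card (partitions_upto T n))"
    define r where "r = real ((n + 1) ^ (2 * K))"
    have s: "s > 0" using card_partitions_upto_pos by (simp add: s_def)
    have "real K * a \<le> s + real K * r"
      using of_nat_mono[OF card_partitions_into_le[of K T n], where 'a = real]
      unfolding a_def s_def r_def by (simp only: of_nat_add of_nat_mult)
    then have "a / s \<le> 1 / real K + r / s"
      using s K(1) by (simp add: field_simps)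
    also have "\<dots> < e" using N[OF \<open>n \<ge> N\<close>] K(2) unfolding r_def s_def by linarith
    finally show "norm (real (card (partitions_into T n)) / real (card (partitions_upto T n)) - 0) < e"
      by (simp add: a_def s_def)
  qed
qed

text \<open>A prime \<open>q\<close> divides \<open>fact k\<close> exactly when
  \<open>q \<le> k\<close>. So \<open>q\<close> divides the common product, and some
  \<open>k\<close> in \<open>Q\<close> satisfies \<open>q \<le> k\<close>; the bound on
  \<open>Q\<close> forces \<open>k = q\<close>.\<close>

lemma max_prime_part_transfer:
  fixes P Q :: "nat multiset"
  assumes "q \<in># P" "prime q" "\<And>k. k \<in># Q \<Longrightarrow> k \<le> q"
    and "(\<Prod>k\<in>#P. fact k :: nat) = (\<Prod>k\<in>#Q. fact k)"
  shows "q \<in># Q"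
proof -
  have "q dvd (fact q :: nat)" using assms(2) by (simp add: prime_dvd_fact_iff)
  also have "fact q dvd (\<Prod>k\<in>#P. fact k :: nat)"
    using assms(1) by (intro dvd_prod_mset) auto
  finally have "q dvd (\<Prod>k\<in>#Q. fact k :: nat)" using assms(4) by simp
  then obtain k where "k \<in># Q" "q dvd (fact k :: nat)"
    using assms(2) by (auto simp: prime_dvd_prod_mset_iff)
  then show ?thesis
    using assms(2,3) by (metis le_antisym prime_dvd_fact_iff)
qed

lemma prod_fact_prime_multiset_inject:
  fixes P Q :: "nat multiset"
  assumes "\<And>k. k \<in># P + Q \<Longrightarrow> prime k"
    and "(\<Prod>k\<in>#P. fact k :: nat) = (\<Prod>k\<in>#Q. fact k)"
  shows "P = Q"
  using assms
proof (induction "size P" arbitrary: P Q rule: less_induct)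
  case less
  show ?case
  proof (cases "P + Q = {#}")
    case False
    \<comment> \<open>The maximum over both multisets bounds each of them, so whichever contains
      \<open>q\<close> passes it on to the other. This also covers the case that just one of them is
      empty.\<close>
    define q where "q = Max_mset (P + Q)"
    have q: "q \<in># P + Q" using False unfolding q_def by (intro Max_in) auto
    have le: "k \<le> q" if "k \<in># P + Q" for k
      using that unfolding q_def by (intro Max_ge) auto
    have "prime q" using q less.prems by blast
    then have "q \<in># P" "q \<in># Q"
      using q le max_prime_part_transfer[of q P Q] max_prime_part_transfer[of q Q P] less.prems(2)
      by auto
    then obtain P' Q' where eq: "P = add_mset q P'" "Q = add_mset q Q'"
      by (meson multi_member_split)
    \<comment> \<open>Cancelling \<open>fact q\<close> on both sides gives equal products for the
      smaller multisets.\<close>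
    have "P' = Q'" using less.prems unfolding eq by (intro less.hyps) (auto simp: eq)
    then show ?thesis by (simp add: eq)
  qed simp
qed

text \<open>Padding with ones brings every sum to \<open>n\<close>, so all numerators are
  \<open>fact n\<close>, while \<open>fact 1 = 1\<close> leaves the denominators unchanged. Equal
  multinomials thus mean equal products of factorials of primes.\<close>

lemma card_prime_partitions_upto_le:
  "card (partitions_upto {p. prime p} n) \<le> num_multinomials ({1} \<union> {p. prime p}) n"
proof -
  let ?B = "partitions_upto {p. prime p} n"
  let ?pad = "\<lambda>P. P + replicate_mset (n - \<Sum>\<^sub># P) (1::nat)"
  have sum: "\<Sum>\<^sub># (?pad P) = n" if "P \<in> ?B" for P
    using that by (simp add: partitions_upto_def)
  have "inj_on (\<lambda>P. multinomial_of (?pad P)) ?B"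
  proof (rule inj_onI)
    fix P Q assume PQ: "P \<in> ?B" "Q \<in> ?B" and eq: "multinomial_of (?pad P) = multinomial_of (?pad Q)"
    \<comment> \<open>Multinomials are real; the cast moves their equality to the naturals, where
      divisibility by primes applies.\<close>
    have cast: "real (\<Prod>k\<in>#R. fact k) = (\<Prod>k\<in>#R. fact k)" for R :: "nat multiset"
      by (induction R) auto
    have "multinomial_of (?pad R) = fact n / real (\<Prod>k\<in>#R. fact k)" if "R \<in> ?B" for R
      using sum[OF that] by (simp add: multinomial_of_def cast)
    then have "fact n / real (\<Prod>k\<in>#P. fact k) = fact n / real (\<Prod>k\<in>#Q. fact k)"
      using PQ eq by simp
    then have "real (\<Prod>k\<in>#P. fact k) = real (\<Prod>k\<in>#Q. fact k)"
      by (simp add: field_simps)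
    then have "(\<Prod>k\<in>#P. fact k :: nat) = (\<Prod>k\<in>#Q. fact k)"
      by (simp only: of_nat_eq_iff)
    then show "P = Q"
      using PQ by (intro prod_fact_prime_multiset_inject) (auto simp: partitions_upto_def)
  qed
  moreover have "(\<lambda>P. multinomial_of (?pad P)) ` ?B
      \<subseteq> multinomial_of ` partitions_into ({1} \<union> {p. prime p}) n"
  proof clarify
    fix P assume P: "P \<in> ?B"
    then have "?pad P \<in> partitions_into ({1} \<union> {p. prime p}) n"
      using sum[OF P] by (auto simp: partitions_into_def partitions_upto_def split: if_splits)
    then show "multinomial_of (?pad P) \<in> multinomial_of ` partitions_into ({1} \<union> {p. prime p}) n"
      by (rule imageI)
  qed
  ultimately show ?thesis
    unfolding num_multinomials_def by (rule card_inj_on_le) (simp add: finite_partitions_into)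
qed

lemma num_multinomials_mono:
  assumes "S \<subseteq> T"
  shows "num_multinomials S n \<le> num_multinomials T n"
  unfolding num_multinomials_def
  using assms by (intro card_mono image_mono finite_imageI finite_partitions_into)
    (auto simp: partitions_into_def)

theorem theorem12:
  shows "(\<lambda>n. real (num_prime_partitions n) / real (num_multinomials ({1} \<union> {p. prime p}) n))
           \<longlonglongrightarrow> 0 \<and>
         (\<lambda>n. real (num_prime_partitions n) / real (num_multinomials {0<..} n))
           \<longlonglongrightarrow> 0"
proof -
  let ?s = "\<lambda>n. card (partitions_upto {p. prime p} n)"
  have lim: "(\<lambda>n. real (num_prime_partitions n) / real (?s n)) \<longlonglongrightarrow> 0"
    unfolding num_prime_partitions_def
    by (rule partitions_into_over_upto_tendsto_0) (rule primes_infinite)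
  \<comment> \<open>Both denominators of the theorem dominate \<open>?s\<close>, so one comparison
    serves both limits.\<close>
  have *: "(\<lambda>n. real (num_prime_partitions n) / real (M n)) \<longlonglongrightarrow> 0"
    if M: "\<And>n. ?s n \<le> M n" for M :: "nat \<Rightarrow> nat"
  proof (rule tendsto_sandwich[OF _ _ tendsto_const lim])
    show "eventually (\<lambda>n. real (num_prime_partitions n) / real (M n)
        \<le> real (num_prime_partitions n) / real (?s n)) sequentially"
    proof (intro always_eventually allI)
      fix n
      show "real (num_prime_partitions n) / real (M n) \<le> real (num_prime_partitions n) / real (?s n)"
        using M[of n] card_partitions_upto_pos[of "{p. prime p}" n]
        by (intro divide_left_mono mult_pos_pos) auto
    qed
  qed simp
  have "num_multinomials ({1} \<union> {p. prime p}) n \<le> num_multinomials {0<..} n" for n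
    by (rule num_multinomials_mono) (auto simp: prime_gt_0_nat)
  then have "?s n \<le> num_multinomials {0<..} n" for n
    using card_prime_partitions_upto_le le_trans by blast
  then show ?thesis
    using *[OF card_prime_partitions_upto_le] *[of "num_multinomials {0<..}"] by blast
qed

end
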